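(* For every fixed $\alpha>0$ and $d=d(n)$ with $1\ll d\ll\sqrt{n}$ there exists a constant $\beta>0$ such that, if $G$ is a graph sampled from $\mathcal{G}_{n,d}$ and $\widehat{G}$ is obtained from $G$ by deleting every vertex independently with probability $p=n^{-\alpha}$, then w.h.p. $\widehat{G}$ is a $\beta$-expander.
   Context: $\mathcal{G}_{n,d}$ is the uniform probability distribution on all (simple) $d$-regular graphs on $n$ labeled vertices, where $dn$ is even. The notation $1\ll d\ll\sqrt n$ means $d=d(n)\to\infty$ and $d/\sqrt n\to 0$ as $n\to\infty$. For $U\subseteq V(H)$, $N_H(U)=\{v\notin U: v\text{ has a neighbor in }U\}$. A graph $H$ on $m$ vertices is a $\beta$-expander ($\beta>0$ constant) if $|N_H(U)|\ge\beta|U|$ for every set $U$ of at most $m/2$ vertices. Deletion process: given $G$, each vertex is deleted independently with probability $n^{-\alpha}$; $\widehat{G}$ is the subgraph of $G$ induced by the non-deleted vertices. An event holds w.h.p. if its probability (over both the choice of $G$ and the deletions) tends to $1$ as $n\to\infty$. *)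

theory Defs
  imports "HOL-Probability.Probability" "HOL-Probability.Product_PMF"
begin

text \<open>A graph is a pair of a vertex set and a set of edges, each edge being a
  two-element set of vertices.\<close>

type_synonym 'a graph = "'a set \<times> 'a set set"

definition simple_graph :: "'a graph \<Rightarrow> bool" where
  "simple_graph G \<longleftrightarrow> finite (fst G) \<and> (\<forall>e\<in>snd G. e \<subseteq> fst G \<and> card e = 2)"

definition degree :: "'a graph \<Rightarrow> 'a \<Rightarrow> nat" where
  "degree G v = card {e \<in> snd G. v \<in> e}"

definition regular_graphs :: "nat \<Rightarrow> nat \<Rightarrow> nat graph set" where
  "regular_graphs n d =
     {G. simple_graph G \<and> fst G = {..<n} \<and> (\<forall>v\<in>fst G. degree G v = d)}"

text \<open>The uniform distribution is meaningful only if there is a \<open>d\<close>-regular graph on \<open>n\<close>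
  vertices, that is, if \<open>d * n\<close> is even and \<open>d < n\<close> (or \<open>n = 0\<close>); otherwise
  \<^const>\<open>pmf_of_set\<close> is applied to the empty set and its value is unspecified.\<close>

definition random_regular_graph :: "nat \<Rightarrow> nat \<Rightarrow> nat graph pmf" where
  "random_regular_graph n d = pmf_of_set (regular_graphs n d)"

definition nbhd :: "'a graph \<Rightarrow> 'a set \<Rightarrow> 'a set" where
  "nbhd H U = {v \<in> fst H - U. \<exists>u\<in>U. {u, v} \<in> snd H}"

definition expander :: "real \<Rightarrow> 'a graph \<Rightarrow> bool" where
  "expander \<beta> H \<longleftrightarrow>
     (\<forall>U. U \<subseteq> fst H \<and> real (card U) \<le> real (card (fst H)) / 2 \<longrightarrow>
        real (card (nbhd H U)) \<ge> \<beta> * real (card U))"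

definition induced_subgraph :: "'a graph \<Rightarrow> 'a set \<Rightarrow> 'a graph" where
  "induced_subgraph G W = (W, {e \<in> snd G. e \<subseteq> W})"

text \<open>One independent coin per vertex; \<^const>\<open>True\<close> means that the vertex is deleted.
  The argument \<^const>\<open>False\<close> of \<^const>\<open>Pi_pmf\<close> is only the value of the
  coin family outside the vertex set.\<close>

definition random_deletion :: "real \<Rightarrow> 'a graph \<Rightarrow> 'a graph pmf" where
  "random_deletion p G =
     map_pmf (\<lambda>del. induced_subgraph G {v \<in> fst G. \<not> del v})
       (Pi_pmf (fst G) False (\<lambda>_. bernoulli_pmf p))"

text \<open>The joint experiment: first the choice of the graph, then the deletions.\<close>

definition deleted_regular_graph :: "nat \<Rightarrow> nat \<Rightarrow> real \<Rightarrow> nat graph pmf" where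
  "deleted_regular_graph n d p = bind_pmf (random_regular_graph n d) (random_deletion p)"

text \<open>The limit \<open>n \<rightarrow> \<infinity>\<close> along those \<open>n\<close> for which \<open>d n * n\<close> is even. It
  is the ordinary limit if this holds for all \<open>n\<close>.\<close>

definition even_product :: "(nat \<Rightarrow> nat) \<Rightarrow> nat filter" where
  "even_product d = inf sequentially (principal {n. even (d n * n)})"

end

theory Submission
  imports Defs "HOL-Real_Asymp.Real_Asymp"
begin

text \<open>
  The proof separates the randomness of the graph from that of the deletions.

  A random regular graph has, with high probability, more than \<open>d u / 8\<close> edges leaving every nonempty
  set \<open>U\<close> of \<open>u \<le> n / 2\<close> vertices. For a fixed \<open>U\<close>, the \<open>d\<close>-regular graphs are sorted into levels by
  their number of edges leaving \<open>U\<close>. Exchanging an edge inside \<open>U\<close> and an edge outside \<open>U\<close> for two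
  edges across moves a graph up by two levels. When few edges leave \<open>U\<close>, there are many more
  exchanges upwards than downwards, so a level has at most \<open>u / (4 n)\<close> times the size of
  the level two above it (lemma \<open>cut_class_ratio\<close>). Climbing about \<open>d u / 16\<close> times shows that
  the graphs with at most \<open>d u / 8\<close> leaving edges are at most a fraction of about
  \<open>u / (4 n)\<close> to the power \<open>d u / 16\<close>. This beats the number of sets of size \<open>u\<close>, uniformly in \<open>u\<close>, as
  soon as \<open>d\<close> is large (lemma \<open>card_not_edge_expanding\<close>).

  The deletions cost every vertex at most \<open>d / 16\<close> of its neighbours, with high probability: a given
  family of \<open>d / 16\<close> neighbours disappears with probability \<open>n\<close> to the power \<open>- \<alpha> d / 16\<close>, and as
  \<open>d\<close> tends to infinity this outweighs the \<open>n\<close> choices of the vertex and the at most \<open>2 ^ d\<close> choices of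
  the family (lemma \<open>prob_deletion_not_expander\<close>).

  If both events occur, more than \<open>d u / 16\<close> of the edges leaving \<open>U\<close> survive, and since a vertex
  receives at most \<open>d\<close> of them, \<open>U\<close> keeps at least \<open>u / 16\<close> neighbours
  (lemma \<open>expander_induced_subgraph\<close>). Hence \<open>\<beta> = 1 / 16\<close> works for all \<open>\<alpha>\<close> and \<open>d\<close>.
\<close>

section \<open>Edges leaving a vertex set\<close>

definition nbrs :: "'a graph \<Rightarrow> 'a \<Rightarrow> 'a set" where
  "nbrs G v = {w. {v, w} \<in> snd G}"

text \<open>Edges are counted by ordered pairs. A crossing edge is listed once, with its end in \<open>U\<close>
  first; an internal edge is listed in both orientations, so that the two counts add up to the sum
  of the degrees in \<open>U\<close>.\<close>

definition crossing :: "'a graph \<Rightarrow> 'a set \<Rightarrow> ('a \<times> 'a) set" where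
  "crossing G U = {(x, a). x \<in> U \<and> a \<in> fst G - U \<and> {x, a} \<in> snd G}"

definition internal :: "'a graph \<Rightarrow> 'a set \<Rightarrow> ('a \<times> 'a) set" where
  "internal G U = {(x, y). x \<in> U \<and> y \<in> U \<and> {x, y} \<in> snd G}"

lemma nbrs_subset: "simple_graph G \<Longrightarrow> nbrs G v \<subseteq> fst G - {v}"
  unfolding simple_graph_def nbrs_def by fastforce

lemma finite_nbrs: "simple_graph G \<Longrightarrow> finite (nbrs G v)"
  by (metis finite_Diff finite_subset nbrs_subset simple_graph_def)

lemma degree_eq_card_nbrs:
  assumes "simple_graph G"
  shows "degree G v = card (nbrs G v)"
proof -
  have "{e \<in> snd G. v \<in> e} = (\<lambda>w. {v, w}) ` nbrs G v"
  proof (intro equalityI subsetI)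
    fix e assume e: "e \<in> {e \<in> snd G. v \<in> e}"
    then have "card e = 2" using assms by (auto simp: simple_graph_def)
    then obtain w where "e = {v, w}" using e by (auto simp: card_2_iff)
    then show "e \<in> (\<lambda>w. {v, w}) ` nbrs G v" using e by (auto simp: nbrs_def)
  qed (auto simp: nbrs_def)
  moreover have "inj_on (\<lambda>w. {v, w}) (nbrs G v)"
    by (auto simp: inj_on_def doubleton_eq_iff)
  ultimately show ?thesis by (simp add: degree_def card_image)
qed

lemma finite_crossing_internal:
  assumes "simple_graph G" "U \<subseteq> fst G"
  shows "finite (crossing G U)" "finite (internal G U)"
proof -
  have f: "finite (fst G \<times> fst G)" using assms by (simp add: simple_graph_def)
  show "finite (crossing G U)" using assms(2)
    by (intro finite_subset[OF _ f]) (auto simp: crossing_def)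
  show "finite (internal G U)" using assms(2)
    by (intro finite_subset[OF _ f]) (auto simp: internal_def)
qed

lemma card_internal_plus_crossing:
  assumes "simple_graph G" "U \<subseteq> fst G" "\<And>v. v \<in> U \<Longrightarrow> degree G v = d"
  shows "card (internal G U) + card (crossing G U) = d * card U"
proof -
  have "card (internal G U) + card (crossing G U) = card (internal G U \<union> crossing G U)"
    using finite_crossing_internal[OF assms(1,2)]
    by (subst card_Un_disjoint) (auto simp: internal_def crossing_def)
  also have "internal G U \<union> crossing G U = Sigma U (nbrs G)"
    using nbrs_subset[OF assms(1)] unfolding internal_def crossing_def nbrs_def by fast
  also have "card \<dots> = (\<Sum>x\<in>U. card (nbrs G x))"
    using assms(1,2) by (intro card_SigmaI) (auto simp: finite_nbrs simple_graph_def finite_subset)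
  also have "\<dots> = d * card U"
    using assms by (simp flip: degree_eq_card_nbrs)
  finally show ?thesis .
qed

lemma card_crossing_complement:
  assumes "U \<subseteq> fst G"
  shows "card (crossing G (fst G - U)) = card (crossing G U)"
proof -
  have "crossing G (fst G - U) = prod.swap ` crossing G U"
    using assms by (force simp: crossing_def insert_commute)
  then show ?thesis by (simp add: card_image)
qed

section \<open>Switchings\<close>

text \<open>The switching replaces the edges \<open>xy\<close> inside \<open>U\<close> and \<open>ab\<close> outside \<open>U\<close> by the two crossing
  edges \<open>xa\<close> and \<open>yb\<close>. The orientations of \<open>xy\<close> and \<open>ab\<close> determine which ends get joined.\<close>

definition switch :: "'a graph \<Rightarrow> 'a \<Rightarrow> 'a \<Rightarrow> 'a \<Rightarrow> 'a \<Rightarrow> 'a graph" where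
  "switch G x y a b = (fst G, snd G - {{x, y}, {a, b}} \<union> {{x, a}, {y, b}})"

definition switchable :: "'a graph \<Rightarrow> 'a set \<Rightarrow> (('a \<times> 'a) \<times> ('a \<times> 'a)) set" where
  "switchable G U = {((x, y), (a, b)). (x, y) \<in> internal G U \<and> (a, b) \<in> internal G (fst G - U) \<and>
     {x, a} \<notin> snd G \<and> {y, b} \<notin> snd G}"

lemma switchable_distinct:
  assumes "simple_graph G" "((x, y), (a, b)) \<in> switchable G U"
  shows "x \<noteq> y" "a \<noteq> b" "x \<noteq> a" "x \<noteq> b" "y \<noteq> a" "y \<noteq> b"
proof -
  have "z \<noteq> w" if "{z, w} \<in> snd G" for z w
    using that assms(1) by (auto simp: simple_graph_def)
  then show "x \<noteq> y" "a \<noteq> b" using assms(2) by (auto simp: switchable_def internal_def)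
  show "x \<noteq> a" "x \<noteq> b" "y \<noteq> a" "y \<noteq> b" using assms(2) by (auto simp: switchable_def internal_def)
qed

text \<open>Each of the four vertices involved loses exactly one edge and gains exactly one.\<close>

lemma degree_switch:
  assumes G: "simple_graph G" and sw: "((x, y), (a, b)) \<in> switchable G U"
  shows "degree (switch G x y a b) v = degree G v"
proof -
  note D = switchable_distinct[OF assms]
  have E: "{x, y} \<in> snd G" "{a, b} \<in> snd G" "{x, a} \<notin> snd G" "{y, b} \<notin> snd G"
    using sw by (auto simp: switchable_def internal_def)
  define I where "I = {e \<in> snd G. v \<in> e}"
  have "finite (snd G)"
    using G by (intro finite_subset[of "snd G" "Pow (fst G)"]) (auto simp: simple_graph_def)
  then have fin: "finite I" by (simp add: I_def)
  have swap: "card (I - {e} \<union> {f}) = card I" if "e \<in> I" "f \<notin> I" for e f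
    using that fin card_Suc_Diff1[OF fin, of e] by simp
  let ?I' = "{e \<in> snd (switch G x y a b). v \<in> e}"
  have exchange: "card ?I' = card I"
    if "{{x, y}, {a, b}} = {e, e'}" "{{x, a}, {y, b}} = {f, f'}" "v \<in> e" "v \<notin> e'" "v \<in> f" "v \<notin> f'"
    for e e' f f'
  proof -
    have "snd (switch G x y a b) = snd G - {e, e'} \<union> {f, f'}"
      by (simp only: switch_def snd_conv that(1,2))
    then have "?I' = I - {e} \<union> {f}" using that(3-6) unfolding I_def by blast
    moreover have "e \<in> {{x, y}, {a, b}}" "f \<in> {{x, a}, {y, b}}"
      unfolding that(1,2) by simp_all
    then have "e \<in> I" "f \<notin> I" using that(3) E unfolding I_def by auto
    ultimately show ?thesis using swap by simp
  qed
  consider "v = x" | "v = y" | "v = a" | "v = b" | "v \<notin> {x, y, a, b}" by blast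
  then have "card ?I' = card I"
  proof cases
    case 1
    then show ?thesis using D by (intro exchange[of "{x, y}" "{a, b}" "{x, a}" "{y, b}"]) simp_all
  next
    case 2
    then show ?thesis using D by (intro exchange[of "{x, y}" "{a, b}" "{y, b}" "{x, a}"]) (simp_all add: insert_commute)
  next
    case 3
    then show ?thesis using D by (intro exchange[of "{a, b}" "{x, y}" "{x, a}" "{y, b}"]) (simp_all add: insert_commute)
  next
    case 4
    then show ?thesis using D by (intro exchange[of "{a, b}" "{x, y}" "{y, b}" "{x, a}"]) (simp_all add: insert_commute)
  next
    case 5
    then have "v \<notin> {x, y}" "v \<notin> {a, b}" "v \<notin> {x, a}" "v \<notin> {y, b}" by auto
    then have "?I' = I" unfolding I_def switch_def snd_conv by blast
    then show ?thesis by simp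
  qed
  then show ?thesis by (simp add: degree_def I_def)
qed

lemma simple_graph_switch:
  assumes "simple_graph G" "((x, y), (a, b)) \<in> switchable G U" "U \<subseteq> fst G"
  shows "simple_graph (switch G x y a b)"
  using switchable_distinct[OF assms(1,2)] assms
  by (auto simp: simple_graph_def switch_def switchable_def internal_def)

lemma crossing_switch:
  assumes "simple_graph G" "((x, y), (a, b)) \<in> switchable G U" "U \<subseteq> fst G"
  shows "crossing (switch G x y a b) U = crossing G U \<union> {(x, a), (y, b)}"
proof -
  have U: "x \<in> U" "y \<in> U" "a \<in> fst G - U" "b \<in> fst G - U"
    using assms(2) by (auto simp: switchable_def internal_def)
  have "{u, w} \<in> snd (switch G x y a b) \<longleftrightarrow> {u, w} \<in> snd G \<or> (u, w) \<in> {(x, a), (y, b)}"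
    if "u \<in> U" "w \<notin> U" for u w
  proof -
    have "{u, w} \<noteq> {x, y}" "{u, w} \<noteq> {a, b}" using U that by (auto simp: doubleton_eq_iff)
    moreover have "{u, w} = {x, a} \<longleftrightarrow> u = x \<and> w = a" "{u, w} = {y, b} \<longleftrightarrow> u = y \<and> w = b"
      using U that by (auto simp: doubleton_eq_iff)
    ultimately show ?thesis unfolding switch_def by simp blast
  qed
  moreover have "fst (switch G x y a b) = fst G" by (simp add: switch_def)
  ultimately show ?thesis using U unfolding crossing_def by blast
qed

lemma card_crossing_switch:
  assumes "simple_graph G" "((x, y), (a, b)) \<in> switchable G U" "U \<subseteq> fst G"
  shows "card (crossing (switch G x y a b) U) = card (crossing G U) + 2"
proof -
  have "(x, a) \<notin> crossing G U" "(y, b) \<notin> crossing G U" using assms(2) by (auto simp: crossing_def switchable_def)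
  then show ?thesis
    using finite_crossing_internal(1)[OF assms(1,3)] switchable_distinct(1)[OF assms(1,2)]
    by (simp add: crossing_switch[OF assms] card_insert_if)
qed

lemma switch_inverse:
  assumes "((x, y), (a, b)) \<in> switchable G U"
  shows "(fst (switch G x y a b), snd (switch G x y a b) - {{x, a}, {y, b}} \<union> {{x, y}, {a, b}}) = G"
proof -
  have "{x, y} \<in> snd G" "{a, b} \<in> snd G" "{x, a} \<notin> snd G" "{y, b} \<notin> snd G"
    using assms by (auto simp: switchable_def internal_def)
  then have "snd (switch G x y a b) - {{x, a}, {y, b}} \<union> {{x, y}, {a, b}} = snd G"
    unfolding switch_def snd_conv by blast
  then show ?thesis by (simp add: switch_def)
qed

definition regular_graph :: "nat \<Rightarrow> 'a graph \<Rightarrow> bool" where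
  "regular_graph d G \<longleftrightarrow> simple_graph G \<and> (\<forall>v\<in>fst G. degree G v = d)"

text \<open>A pair of oriented internal edges fails to be switchable only if \<open>xa\<close> or \<open>yb\<close> is already
  an edge. Such a pair is found by choosing that crossing edge and then one neighbour of each of its
  ends, which leaves \<open>d\<^sup>2\<close> choices per crossing edge for each of the two reasons.\<close>

lemma card_switchable_ge:
  assumes G: "regular_graph d G" and U: "U \<subseteq> fst G"
  shows "card (internal G U) * card (internal G (fst G - U)) \<le> card (switchable G U) + 2 * card (crossing G U) * d\<^sup>2"
proof -
  have s: "simple_graph G" using G by (simp add: regular_graph_def)
  \<comment> \<open>An element of \<open>?P\<close> is a crossing edge with a neighbour of each end. It yields two possibly
      unswitchable pairs, according to whether the crossing edge plays the role of \<open>xa\<close> or of \<open>yb\<close>.\<close>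
  let ?P = "SIGMA (x, a) : crossing G U. nbrs G x \<times> nbrs G a"
  have fc: "finite (crossing G U)" using finite_crossing_internal[OF s U] by simp
  have fP: "finite ?P" using fc finite_nbrs[OF s] by (auto intro!: finite_SigmaI)
  have cP: "card ?P = card (crossing G U) * d\<^sup>2"
  proof -
    have "card ?P = (\<Sum>(x, a)\<in>crossing G U. card (nbrs G x \<times> nbrs G a))"
      using fc finite_nbrs[OF s] by (subst card_SigmaI) (auto simp: case_prod_unfold)
    also have "\<dots> = (\<Sum>(x, a)\<in>crossing G U. d\<^sup>2)"
    proof (intro sum.cong refl, clarify)
      fix x a assume "(x, a) \<in> crossing G U"
      then have "x \<in> fst G" "a \<in> fst G" using U by (auto simp: crossing_def)
      then show "card (nbrs G x \<times> nbrs G a) = d\<^sup>2"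
        using G by (simp add: regular_graph_def card_cartesian_product power2_eq_square flip: degree_eq_card_nbrs[OF s])
    qed
    also have "\<dots> = card (crossing G U) * d\<^sup>2" by (simp add: case_prod_unfold)
    finally show ?thesis .
  qed
  let ?f = "\<lambda>((x, a), (y, b)). ((x, y), (a, b))"
  let ?g = "\<lambda>((y, b), (x, a)). ((x, y), (a, b))"
  have "internal G U \<times> internal G (fst G - U) \<subseteq> switchable G U \<union> (?f ` ?P \<union> ?g ` ?P)"
  proof
    fix t assume t: "t \<in> internal G U \<times> internal G (fst G - U)"
    obtain x y a b where xy: "t = ((x, y), (a, b))" by (metis prod.collapse)
    have xa: "x \<in> U" "y \<in> U" "a \<in> fst G - U" "b \<in> fst G - U" "{x, y} \<in> snd G" "{a, b} \<in> snd G"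
      using t by (auto simp: xy internal_def)
    consider "{x, a} \<in> snd G" | "{y, b} \<in> snd G" | "{x, a} \<notin> snd G" "{y, b} \<notin> snd G" by blast
    then show "t \<in> switchable G U \<union> (?f ` ?P \<union> ?g ` ?P)"
    proof cases
      case 1
      then have "((x, a), (y, b)) \<in> ?P" using xa by (simp add: crossing_def nbrs_def)
      then have "t \<in> ?f ` ?P" by (rule rev_image_eqI) (simp add: xy)
      then show ?thesis by blast
    next
      case 2
      then have "((y, b), (x, a)) \<in> ?P" using xa by (simp add: crossing_def nbrs_def insert_commute)
      then have "t \<in> ?g ` ?P" by (rule rev_image_eqI) (simp add: xy)
      then show ?thesis by blast
    next
      case 3
      then show ?thesis using t by (simp add: switchable_def xy)
    qed
  qed
  moreover have fs: "finite (switchable G U)"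
    using finite_crossing_internal(2)[OF s U] finite_crossing_internal(2)[OF s, of "fst G - U"]
    by - (rule finite_subset[of _ "internal G U \<times> internal G (fst G - U)"], auto simp: switchable_def)
  ultimately have "card (internal G U \<times> internal G (fst G - U)) \<le> card (switchable G U \<union> (?f ` ?P \<union> ?g ` ?P))"
    using fP by (intro card_mono) auto
  also have "\<dots> \<le> card (switchable G U) + (card (?f ` ?P) + card (?g ` ?P))"
    by (meson card_Un_le add_left_mono le_trans)
  also have "\<dots> \<le> card (switchable G U) + (card ?P + card ?P)"
    using fP by (intro add_mono card_image_le) auto
  finally show ?thesis by (simp add: cP card_cartesian_product)
qed

definition cut_class :: "'a set \<Rightarrow> nat \<Rightarrow> 'a set \<Rightarrow> nat \<Rightarrow> 'a graph set" where
  "cut_class V d U k = {G. regular_graph d G \<and> fst G = V \<and> card (crossing G U) = k}"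

lemma finite_regular_graphs_on: "finite V \<Longrightarrow> finite {G. regular_graph d G \<and> fst G = V}"
  by (rule finite_subset[of _ "{V} \<times> Pow (Pow V)"])
    (auto simp: regular_graph_def simple_graph_def)

text \<open>Double counting of the switchings from level \<open>k\<close> to level \<open>k + 2\<close>. The switched graph and the
  ordered pair of its two new crossing edges determine the original graph, so each graph on the
  upper level is reached in at most \<open>(k + 2)\<^sup>2\<close> ways.\<close>

lemma switching_count:
  assumes V: "finite V" and U: "U \<subseteq> V"
    and m: "\<And>G. G \<in> cut_class V d U k \<Longrightarrow> m \<le> card (switchable G U)"
  shows "m * card (cut_class V d U k) \<le> (k + 2)\<^sup>2 * card (cut_class V d U (k + 2))"
proof -
  have fin: "finite (cut_class V d U k)" for k
    using finite_regular_graphs_on[OF V, of d]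
    by - (erule rev_finite_subset, auto simp: cut_class_def)
  have sim: "simple_graph G" "fst G = V" if "G \<in> cut_class V d U k" for G k
    using that by (auto simp: cut_class_def regular_graph_def)
  have fsw: "finite (switchable G U)" if "G \<in> cut_class V d U k" for G
    using V U sim(2)[OF that] by - (rule finite_subset[of _ "(V \<times> V) \<times> (V \<times> V)"], auto simp: switchable_def internal_def)
  have fcr: "finite (crossing G U)" if "G \<in> cut_class V d U k" for G k
    using sim[OF that] U finite_crossing_internal(1) by blast
  let ?S = "SIGMA G : cut_class V d U k. switchable G U"
  let ?T = "SIGMA H : cut_class V d U (k + 2). crossing H U \<times> crossing H U"
  let ?f = "\<lambda>(G, (x, y), (a, b)). (switch G x y a b, (x, a), (y, b))"
  let ?g = "\<lambda>(H, (x, a), (y, b)). ((fst H, snd H - {{x, a}, {y, b}} \<union> {{x, y}, {a, b}}), (x, y), (a, b))"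
  have "m * card (cut_class V d U k) = (\<Sum>G\<in>cut_class V d U k. m)" by simp
  also have "\<dots> \<le> (\<Sum>G\<in>cut_class V d U k. card (switchable G U))" by (intro sum_mono m)
  also have "\<dots> = card ?S" using fin fsw by (intro card_SigmaI[symmetric]) auto
  also have "\<dots> \<le> card ?T"
  proof (rule card_inj_on_le)
    show "inj_on ?f ?S"
    proof (rule inj_on_inverseI[of _ ?g])
      fix t assume "t \<in> ?S"
      moreover obtain G x y a b where t: "t = (G, (x, y), (a, b))" by (metis prod.collapse)
      ultimately have "((x, y), (a, b)) \<in> switchable G U" by simp
      from switch_inverse[OF this] show "?g (?f t) = t" by (simp add: t)
    qed
    show "?f ` ?S \<subseteq> ?T"
    proof (rule image_subsetI)
      fix t assume "t \<in> ?S"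
      moreover obtain G x y a b where t: "t = (G, (x, y), (a, b))" by (metis prod.collapse)
      ultimately have G: "G \<in> cut_class V d U k" and sw: "((x, y), (a, b)) \<in> switchable G U" by simp_all
      note s = sim(1)[OF G]
      have U': "U \<subseteq> fst G" using U sim(2)[OF G] by simp
      have "fst (switch G x y a b) = fst G" by (simp add: switch_def)
      then have "switch G x y a b \<in> cut_class V d U (k + 2)"
        using G simple_graph_switch[OF s sw U'] degree_switch[OF s sw] card_crossing_switch[OF s sw U']
        by (simp add: cut_class_def regular_graph_def)
      then show "?f t \<in> ?T" by (simp add: t crossing_switch[OF s sw U'])
    qed
    show "finite ?T"
      using fin fcr by (intro finite_SigmaI finite_cartesian_product) auto
  qed
  also have "card ?T = (\<Sum>H\<in>cut_class V d U (k + 2). card (crossing H U \<times> crossing H U))"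
    using fin fcr by (intro card_SigmaI) auto
  also have "\<dots> = (\<Sum>H\<in>cut_class V d U (k + 2). (k + 2)\<^sup>2)"
    by (intro sum.cong refl) (auto simp: cut_class_def card_cartesian_product power2_eq_square)
  finally show ?thesis by (simp add: mult.commute)
qed

section \<open>Regular graphs with a small cut are rare\<close>

text \<open>Let \<open>u\<close> be the size of \<open>U\<close> and \<open>n\<close> that of \<open>V\<close>. As long as at most a quarter of the degree
  sum of \<open>U\<close> leaves \<open>U\<close>, there are at least \<open>d\<^sup>2 u (n - u) / 2\<close> switchings upwards, because \<open>d\<close> is
  so small compared with \<open>n\<close> that few are forbidden, but at most \<open>(d u / 4)\<^sup>2\<close> downwards. The
  factor \<open>u / n\<close> that remains is what later makes the union bound work for all sizes \<open>u\<close> at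
  once: the sets of size \<open>u\<close> number about \<open>n / u\<close> to the power \<open>u\<close>, up to a factor exponential
  in \<open>u\<close>.\<close>

lemma cut_class_ratio:
  assumes V: "finite V" "16 * d \<le> card V" and U: "U \<subseteq> V" "2 * card U \<le> card V"
    and k: "4 * (k + 2) \<le> d * card U"
  shows "real (card (cut_class V d U k))
    \<le> real (card U) / (4 * real (card V)) * real (card (cut_class V d U (k + 2)))"
proof -
  define u n c c' where "u = real (card U)" and "n = real (card V)"
    and "c = real (card (cut_class V d U k))" and "c' = real (card (cut_class V d U (k + 2)))"
  let ?m = "(d * card U - k) * (d * (card V - card U) - k) - 2 * k * d\<^sup>2"
  have k4: "4 * real k \<le> d * u" and k2: "4 * real (k + 2) \<le> d * u"
    using of_nat_mono[OF k, where 'a = real] by (simp_all add: u_def)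
  have u0: "0 < u" and d0: "0 < real d" and un: "2 * u \<le> n" "16 * real d \<le> n"
    using k V U by (auto simp: u_def n_def intro: Nat.gr0I)
  have "card U \<le> card V" using V U by (simp add: card_mono)
  then have diff: "real (card V - card U) = n - u" by (simp add: n_def u_def)
  have "?m \<le> card (switchable G U)" if "G \<in> cut_class V d U k" for G
  proof -
    have G: "regular_graph d G" "fst G = V" "card (crossing G U) = k"
      using that by (auto simp: cut_class_def)
    have U': "U \<subseteq> fst G" using G U by simp
    have "card (internal G U) + k = d * card U"
      using card_internal_plus_crossing[of G U d] G U by (auto simp: regular_graph_def)
    moreover have "card (internal G (V - U)) + k = d * (card V - card U)"
      using card_internal_plus_crossing[of G "V - U" d] card_crossing_complement[OF U'] G U V
      by (auto simp: regular_graph_def card_Diff_subset finite_subset)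
    ultimately have i: "card (internal G U) = d * card U - k"
      "card (internal G (V - U)) = d * (card V - card U) - k" by linarith+
    show ?thesis using card_switchable_ge[OF G(1) U'] unfolding G(2,3) i by linarith
  qed
  from switching_count[OF V(1) U(1) this]
  have "real ?m * c \<le> (real (k + 2))\<^sup>2 * c'"
    unfolding c_def c'_def by (simp only: flip: of_nat_mult of_nat_power) (simp only: of_nat_le_iff)
  also have "\<dots> \<le> (d * u / 4)\<^sup>2 * c'"
    using k2 by (intro mult_right_mono power_mono) (auto simp: c'_def)
  finally have up: "real ?m * c \<le> (d * u / 4)\<^sup>2 * c'" .
  have "real ?m \<ge> (d * u - k) * (d * (n - u) - k) - 2 * k * (real d)\<^sup>2"
  proof -
    have "real (a - b) \<ge> real a - real b" for a b :: nat by simp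
    from this[of "(d * card U - k) * (d * (card V - card U) - k)" "2 * k * d\<^sup>2"]
    have "real ?m \<ge> real (d * card U - k) * real (d * (card V - card U) - k) - 2 * k * (real d)\<^sup>2" by simp
    moreover have "k \<le> d * card U" using k by simp
    moreover have "k \<le> d * (card V - card U)"
    proof -
      have "d * card U \<le> d * (card V - card U)" using U by (intro mult_left_mono) auto
      moreover have "k \<le> d * card U" using k by simp
      ultimately show ?thesis by (rule le_trans[rotated])
    qed
    ultimately show ?thesis by (simp add: of_nat_diff u_def diff[unfolded u_def])
  qed
  \<comment> \<open>Three quarters of either degree sum stay internal; with the forbidden pairs removed, the
      fraction of switchable pairs is at least \<open>9 / 16 - 1 / 16 = 1 / 2\<close>.\<close>
  moreover have "(d * u - k) * (d * (n - u) - k) \<ge> (3/4 * (d * u)) * (3/4 * (d * (n - u)))"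
  proof (rule mult_mono)
    have "d * u \<le> d * (n - u)" using un by (intro mult_left_mono) auto
    then show "3/4 * (d * (n - u)) \<le> d * (n - u) - k" using k4 by linarith
  qed (use k4 d0 u0 un in \<open>auto simp: mult_ac\<close>)
  moreover have "2 * k * (real d)\<^sup>2 \<le> 1/16 * ((d * u) * (d * (n - u)))"
  proof -
    have "2 * k * (real d)\<^sup>2 \<le> (d * u) / 2 * (real d)\<^sup>2" using k4 by (intro mult_right_mono) auto
    also have "\<dots> = (d * u) * (d * (d / 2))" by (simp add: power2_eq_square)
    also have "\<dots> \<le> (d * u) * (d * ((n - u) / 16))"
      using un u0 by (intro mult_left_mono) auto
    finally show ?thesis by simp
  qed
  ultimately have "real ?m \<ge> 1/2 * ((d * u) * (d * (n - u)))" by simp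
  then have "1/2 * ((d * u) * (d * (n - u))) * c \<le> real ?m * c"
    by (intro mult_right_mono) (auto simp: c_def)
  with up have "1/2 * ((d * u) * (d * (n - u))) * c \<le> (d * u / 4)\<^sup>2 * c'" by linarith
  then have "(d * u * d) * ((n - u) * c) \<le> (d * u * d) * (u / 8 * c')"
    by (simp add: power2_eq_square field_simps)
  then have "(n - u) * c \<le> u / 8 * c'" using d0 u0 by simp
  moreover have "n / 2 * c \<le> (n - u) * c" using un by (intro mult_right_mono) (auto simp: c_def)
  ultimately have "n / 2 * c \<le> u / 8 * c'" by linarith
  then show ?thesis
    unfolding u_def[symmetric] n_def[symmetric] c_def[symmetric] c'_def[symmetric]
    using un u0 by (simp add: field_simps)
qed

text \<open>From any level below \<open>d u / 8\<close> one can climb \<open>d u / 16\<close> times before the level exceeds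
  \<open>d u / 4\<close>, and every step gains the factor of the preceding lemma. The number of steps is rounded
  down to a multiple of \<open>u\<close>.\<close>

lemma card_small_cut:
  assumes V: "finite V" "16 * d \<le> card V" and U: "U \<subseteq> V" "2 * card U \<le> card V"
  shows "real (card {G. regular_graph d G \<and> fst G = V \<and> 8 * card (crossing G U) \<le> d * card U})
    \<le> (card U / (4 * card V)) ^ (card U * (d div 16)) * card {G. regular_graph d G \<and> fst G = V}"
proof -
  define r where "r = real (card U) / (4 * real (card V))"
  define j where "j = card U * (d div 16)"
  define K where "K = {k. 8 * k \<le> d * card U}"
  have fin: "finite (cut_class V d U k)" for k
    using finite_regular_graphs_on[OF V(1), of d]
    by - (erule rev_finite_subset, auto simp: cut_class_def)
  have "16 * j \<le> d * card U" 
    using mult_right_mono[OF times_div_less_eq_dividend[of 16 d], of "card U"] by (simp add: j_def mult_ac)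
  have step: "real (card (cut_class V d U k)) \<le> r ^ i * card (cut_class V d U (k + 2 * i))"
    if "4 * (k + 2 * i) \<le> d * card U" for i k
    using that
  proof (induction i)
    case (Suc i)
    then have "real (card (cut_class V d U k)) \<le> r ^ i * card (cut_class V d U (k + 2 * i))" by simp
    also have "\<dots> \<le> r ^ i * (r * card (cut_class V d U (k + 2 * i + 2)))"
      using cut_class_ratio[OF V U, of "k + 2 * i"] Suc.prems
      by (intro mult_left_mono) (auto simp: r_def)
    finally show ?case by (simp add: mult_ac)
  qed simp
  have fK: "finite K" by (rule finite_subset[of _ "{..d * card U}"]) (auto simp: K_def)
  have dj: "cut_class V d U k \<inter> cut_class V d U l = {}" if "k \<noteq> l" for k l
    using that by (auto simp: cut_class_def)
  have "{G. regular_graph d G \<and> fst G = V \<and> 8 * card (crossing G U) \<le> d * card U} = (\<Union>k\<in>K. cut_class V d U k)"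
    by (auto simp: K_def cut_class_def)
  then have "real (card {G. regular_graph d G \<and> fst G = V \<and> 8 * card (crossing G U) \<le> d * card U})
      = (\<Sum>k\<in>K. real (card (cut_class V d U k)))"
    using fK fin dj by (simp add: card_UN_disjoint)
  also have "\<dots> \<le> (\<Sum>k\<in>K. r ^ j * card (cut_class V d U (k + 2 * j)))"
    using \<open>16 * j \<le> d * card U\<close> by (intro sum_mono step) (auto simp: K_def)
  also have "\<dots> = r ^ j * card (\<Union>k\<in>K. cut_class V d U (k + 2 * j))"
    using fK fin dj by (simp add: card_UN_disjoint sum_distrib_left)
  also have "\<dots> \<le> r ^ j * card {G. regular_graph d G \<and> fst G = V}"
    using finite_regular_graphs_on[OF V(1)]
    by (intro mult_left_mono of_nat_mono card_mono) (auto simp: r_def cut_class_def)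
  finally show ?thesis by (simp add: r_def j_def)
qed

text \<open>A form of the familiar bound of the binomial coefficient by \<open>e n / u\<close> to the power \<open>u\<close>, with
  \<open>4\<close> in place of \<open>e\<close>.\<close>

lemma binomial_mult_power_le:
  fixes n u :: nat
  assumes "0 < n"
  shows "real (n choose u) * (u / (4 * n)) ^ u \<le> 1"
proof -
  have "real u ^ u / fact u \<le> exp (real u)"
  proof -
    have "(\<Sum>k\<in>{u}. real u ^ k /\<^sub>R fact k) \<le> (\<Sum>k. real u ^ k /\<^sub>R fact k)"
      by (rule sum_le_suminf[OF summable_exp_generic]) auto
    then show ?thesis by (simp add: exp_def divide_inverse mult.commute)
  qed
  also have "exp (real u) = exp 1 ^ u" using exp_of_nat_mult[of u "1::real"] by simp
  also have "\<dots> \<le> 4 ^ u" using exp_le by (intro power_mono) auto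
  finally have e: "real u ^ u \<le> 4 ^ u * fact u" by (simp add: field_simps)
  have b: "real (n choose u) * fact u \<le> real n ^ u"
    using binomial_fact_pow[of n u] by (metis of_nat_fact of_nat_le_iff of_nat_mult of_nat_power)
  have "real (n choose u) * real u ^ u \<le> real (n choose u) * (4 ^ u * fact u)"
    using e by (intro mult_left_mono) auto
  also have "\<dots> \<le> 4 ^ u * real n ^ u" using b by simp
  finally show ?thesis using assms by (simp add: power_divide power_mult_distrib)
qed

text \<open>More than an eighth of the degree sum of \<open>U\<close> leaves \<open>U\<close>.\<close>

definition edge_expanding :: "nat \<Rightarrow> 'a graph \<Rightarrow> bool" where
  "edge_expanding d G \<longleftrightarrow>
    (\<forall>U. U \<subseteq> fst G \<and> U \<noteq> {} \<and> 2 * card U \<le> card (fst G) \<longrightarrow> d * card U < 8 * card (crossing G U))"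

text \<open>Union bound over all vertex sets of size \<open>u \<le> n / 2\<close>. One factor \<open>u / 4n\<close> to the power \<open>u\<close> in
  the bound for a single set pays for the number of these sets, and each of the other
  \<open>d div 16 - 1\<close> such factors is at most \<open>1 / 8\<close> to the power \<open>u\<close>; what is left is a geometric
  series in \<open>u\<close>.\<close>

lemma card_not_edge_expanding:
  assumes V: "finite V" "16 * d \<le> card V" and d: "32 \<le> d"
  shows "real (card {G. regular_graph d G \<and> fst G = V \<and> \<not> edge_expanding d G})
    \<le> 2 * (1 / 8) ^ (d div 16 - 1) * card {G. regular_graph d G \<and> fst G = V}"
proof -
  define n where "n = card V"
  define D where "D = d div 16 - 1"
  define R where "R = {G. regular_graph d G \<and> fst G = V}"
  define B where "B U = {G. regular_graph d G \<and> fst G = V \<and> 8 * card (crossing G U) \<le> d * card U}" for U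
  define q where "q = (1 / 8 :: real) ^ D"
  have D: "1 \<le> D" "d div 16 = Suc D" using d by (auto simp: D_def)
  have n0: "0 < n" using V d by (simp add: n_def)
  have q: "0 \<le> q" "q \<le> 1 / 8"
    using power_decreasing[OF D(1), of "1/8 :: real"] by (auto simp: q_def)
  have fB: "finite (B U)" for U
    using finite_regular_graphs_on[OF V(1), of d] by - (erule rev_finite_subset, auto simp: B_def)
  have fS: "finite {U. U \<subseteq> V \<and> card U = u}" for u using V by simp
  have "{G. regular_graph d G \<and> fst G = V \<and> \<not> edge_expanding d G}
      \<subseteq> (\<Union>u\<in>{1..n div 2}. \<Union>U\<in>{U. U \<subseteq> V \<and> card U = u}. B U)"
  proof
    fix G assume "G \<in> {G. regular_graph d G \<and> fst G = V \<and> \<not> edge_expanding d G}"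
    then obtain U where U: "U \<subseteq> V" "U \<noteq> {}" "2 * card U \<le> card V" "G \<in> B U"
      by (auto simp: edge_expanding_def B_def not_less)
    then have "card U \<in> {1..n div 2}" using V by (auto simp: n_def card_gt_0_iff Suc_le_eq finite_subset)
    then show "G \<in> (\<Union>u\<in>{1..n div 2}. \<Union>U\<in>{U. U \<subseteq> V \<and> card U = u}. B U)" using U by blast
  qed
  then have "card {G. regular_graph d G \<and> fst G = V \<and> \<not> edge_expanding d G}
      \<le> card (\<Union>u\<in>{1..n div 2}. \<Union>U\<in>{U. U \<subseteq> V \<and> card U = u}. B U)"
    using fB fS by (intro card_mono) auto
  also have "\<dots> \<le> (\<Sum>u\<in>{1..n div 2}. card (\<Union>U\<in>{U. U \<subseteq> V \<and> card U = u}. B U))"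
    by (intro card_UN_le) auto
  also have "\<dots> \<le> (\<Sum>u\<in>{1..n div 2}. \<Sum>U\<in>{U. U \<subseteq> V \<and> card U = u}. card (B U))"
    using fS by (intro sum_mono card_UN_le) auto
  finally have "real (card {G. regular_graph d G \<and> fst G = V \<and> \<not> edge_expanding d G})
      \<le> (\<Sum>u\<in>{1..n div 2}. \<Sum>U\<in>{U. U \<subseteq> V \<and> card U = u}. real (card (B U)))"
    by (simp only: of_nat_le_iff flip: of_nat_sum)
  also have "\<dots> \<le> (\<Sum>u\<in>{1..n div 2}. q ^ u * card R)"
  proof (rule sum_mono)
    fix u assume u: "u \<in> {1..n div 2}"
    let ?r = "real u / (4 * real n)"
    have "(\<Sum>U\<in>{U. U \<subseteq> V \<and> card U = u}. real (card (B U)))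
        \<le> (\<Sum>U\<in>{U. U \<subseteq> V \<and> card U = u}. ?r ^ (u * Suc D) * card R)"
    proof (rule sum_mono)
      fix U assume U: "U \<in> {U. U \<subseteq> V \<and> card U = u}"
      then have "2 * card U \<le> card V" using u by (auto simp: n_def)
      then show "real (card (B U)) \<le> ?r ^ (u * Suc D) * card R"
        using card_small_cut[OF V, of U] U unfolding B_def R_def D(2) by (auto simp: n_def)
    qed
    also have "\<dots> = (real (n choose u) * ?r ^ u) * (?r ^ (u * D)) * card R"
      using n_subsets[OF V(1), of u] by (simp add: n_def power_add)
    also have "\<dots> \<le> 1 * (1 / 8) ^ (u * D) * card R"
    proof -
      have "?r \<le> 1 / 8" using u n0 by (auto simp: field_simps)
      then have "?r ^ (u * D) \<le> (1 / 8) ^ (u * D)" by (intro power_mono) auto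
      then show ?thesis
        using binomial_mult_power_le[OF n0, of u] by (intro mult_right_mono mult_mono) auto
    qed
    also have "\<dots> = q ^ u * card R" by (simp add: q_def power_mult mult.commute)
    finally show "(\<Sum>U\<in>{U. U \<subseteq> V \<and> card U = u}. real (card (B U))) \<le> q ^ u * card R" .
  qed
  also have "\<dots> = (\<Sum>u\<in>{1..n div 2}. q ^ u) * card R" by (simp add: sum_distrib_right)
  also have "\<dots> \<le> 2 * q * card R"
  proof (rule mult_right_mono)
    \<comment> \<open>The subtracted term makes the bound inductive: each step costs \<open>q ^ Suc m\<close>, and \<open>2 * q \<le> 1\<close>.\<close>
    have "(\<Sum>u\<in>{1..m}. q ^ u) \<le> 2 * q - 2 * q ^ Suc m" for m
    proof (induction m)
      case (Suc m)
      have "q ^ Suc m * (2 * q) \<le> q ^ Suc m * 1" using q by (intro mult_left_mono) auto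
      then show ?case using Suc q by (auto simp: field_simps)
    qed (use q in simp)
    from this[of "n div 2"] show "(\<Sum>u\<in>{1..n div 2}. q ^ u) \<le> 2 * q"
      using q by (smt (verit) zero_le_mult_iff zero_le_power)
  qed simp
  finally show ?thesis by (simp add: q_def D_def R_def)
qed

section \<open>Existence of regular graphs\<close>

lemma regular_graphs_eq: "regular_graphs n d = {G. regular_graph d G \<and> fst G = {..<n}}"
  by (auto simp: regular_graphs_def regular_graph_def)

text \<open>The nonzero residues of absolute value at most \<open>d div 2\<close> form a set closed under negation,
  of size \<open>d\<close> if \<open>d\<close> is even. If \<open>d\<close> is odd, then \<open>n\<close> is even and the self-inverse residue
  \<open>n / 2\<close> is added.\<close>

lemma symmetric_connection_set:
  assumes "even (d * n)" "d < n"
  shows "\<exists>S. S \<subseteq> {1..<int n} \<and> (\<forall>s\<in>S. int n - s \<in> S) \<and> card S = d"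
proof -
  define k where "k = int (d div 2)"
  define M :: "int set" where "M = (if even d then {} else {int (n div 2)})"
  define S where "S = {1..k} \<union> {int n - k..<int n} \<union> M"
  have nM: "2 * int (n div 2) = int n" "2 * k + 2 \<le> int n" if "odd d"
    using assms that by (auto simp: k_def elim!: oddE evenE)
  have k2: "2 * k < int n" using assms(2) by (auto simp: k_def)
  have "card S = card ({1..k} \<union> {int n - k..<int n}) + card M"
    unfolding S_def using nM by (intro card_Un_disjoint) (auto simp: M_def)
  also have "card ({1..k} \<union> {int n - k..<int n}) = card {1..k} + card {int n - k..<int n}"
    using k2 by (intro card_Un_disjoint) auto
  also have "\<dots> + card M = d" by (auto simp: k_def M_def elim!: evenE oddE)
  finally have "card S = d" .
  moreover have "S \<subseteq> {1..<int n}" using k2 nM by (auto simp: S_def M_def k_def)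
  moreover have "int n - s \<in> S" if "s \<in> S" for s
    using that nM(1) by (cases "even d") (auto simp: S_def M_def)
  ultimately show ?thesis by blast
qed

text \<open>The witness is a circulant graph: residues modulo \<open>n\<close> are adjacent if their difference
  lies in the connection set.\<close>

lemma regular_graphs_nonempty:
  assumes "even (d * n)" "d < n"
  shows "regular_graphs n d \<noteq> {}"
proof -
  obtain S :: "int set" where S: "S \<subseteq> {1..<int n}" "\<And>s. s \<in> S \<Longrightarrow> int n - s \<in> S" "card S = d"
    using symmetric_connection_set[OF assms] by blast
  define adj where "adj i j \<longleftrightarrow> i < n \<and> j < n \<and> (int j - int i) mod int n \<in> S" for i j
  define G :: "nat graph" where "G = ({..<n}, {{i, j} |i j. adj i j})"
  have irr: "i \<noteq> j" if "adj i j" for i j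
    using that S(1) by (auto simp: adj_def)
  have sym: "adj j i" if "adj i j" for i j
  proof -
    have "(int j - int i) mod int n \<noteq> 0" using that S(1) by (auto simp: adj_def)
    then have "(int i - int j) mod int n = int n - (int j - int i) mod int n"
      using zmod_zminus1_eq_if[of "int j - int i" "int n"] by simp
    then show ?thesis using that S(2) by (simp add: adj_def)
  qed
  have "card {i, j} = 2 \<and> {i, j} \<subseteq> {..<n}" if "adj i j" for i j
    using irr[OF that] that by (simp add: adj_def)
  then have simple: "simple_graph G"
    unfolding simple_graph_def G_def by auto
  have "degree G i = d" if i: "i < n" for i
  proof -
    have nb: "nbrs G i = {j. adj i j}"
      using sym by (auto simp: nbrs_def G_def doubleton_eq_iff)
    have "bij_betw (\<lambda>j. (int j - int i) mod int n) {j. adj i j} S"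
    proof (rule bij_betw_byWitness[where f' = "\<lambda>s. nat ((int i + s) mod int n)"])
      show "\<forall>j\<in>{j. adj i j}. nat ((int i + (int j - int i) mod int n) mod int n) = j"
        by (simp add: adj_def mod_add_right_eq)
      have inv: "(int (nat ((int i + s) mod int n)) - int i) mod int n = s" if "s \<in> S" for s
      proof -
        have "int (nat ((int i + s) mod int n)) = (int i + s) mod int n" using i by simp
        then have "(int (nat ((int i + s) mod int n)) - int i) mod int n = s mod int n"
          by (simp add: mod_diff_left_eq)
        then show ?thesis using that S(1) by auto
      qed
      then show "\<forall>s\<in>S. (int (nat ((int i + s) mod int n)) - int i) mod int n = s" by blast
      show "(\<lambda>j. (int j - int i) mod int n) ` {j. adj i j} \<subseteq> S" by (auto simp: adj_def)
      show "(\<lambda>s. nat ((int i + s) mod int n)) ` S \<subseteq> {j. adj i j}"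
        using inv i by (auto simp: adj_def nat_less_iff)
    qed
    then show ?thesis
      using bij_betw_same_card S(3) by (fastforce simp: degree_eq_card_nbrs[OF simple] nb)
  qed
  then have "G \<in> regular_graphs n d" using simple by (simp add: regular_graphs_def G_def)
  then show ?thesis by blast
qed

section \<open>Deleting vertices\<close>

text \<open>More than \<open>d / 8\<close> edges per vertex of \<open>U\<close> leave \<open>U\<close>, and at most \<open>d / 16\<close> of them are lost.
  The remaining ones end in neighbours of \<open>U\<close> that survive, and each such neighbour absorbs at most
  \<open>d\<close> of them.\<close>

lemma expander_induced_subgraph:
  assumes G: "regular_graph d G" "edge_expanding d G" and d: "0 < d" and W: "W \<subseteq> fst G"
    and loss: "\<And>v. v \<in> W \<Longrightarrow> 16 * card (nbrs G v - W) \<le> d"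
  shows "expander (1 / 16) (induced_subgraph G W)"
  unfolding expander_def
proof (intro allI impI)
  let ?H = "induced_subgraph G W"
  fix U assume "U \<subseteq> fst ?H \<and> real (card U) \<le> real (card (fst ?H)) / 2"
  then have U: "U \<subseteq> W" "2 * card U \<le> card W" by (auto simp: induced_subgraph_def)
  have s: "simple_graph G" and fV: "finite (fst G)" using G by (auto simp: regular_graph_def simple_graph_def)
  have fW: "finite W" "finite U" using W U fV by (auto intro: finite_subset)
  show "real (card (nbhd ?H U)) \<ge> 1 / 16 * real (card U)"
  proof (cases "U = {}")
    case False
    have "2 * card U \<le> card (fst G)" using U(2) card_mono[OF fV W] by simp
    then have big: "d * card U < 8 * card (crossing G U)"
      using G(2) U W False by (auto simp: edge_expanding_def)
    let ?N = "nbhd ?H U" and ?lost = "SIGMA x : U. nbrs G x - W"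
    let ?kept = "SIGMA a : ?N. nbrs G a"
    have fN: "finite ?N" using fW by (simp add: nbhd_def induced_subgraph_def)
    have "crossing G U \<subseteq> ?lost \<union> prod.swap ` ?kept"
    proof
      fix e assume e: "e \<in> crossing G U"
      then obtain x a where xa: "e = (x, a)" "x \<in> U" "a \<in> fst G - U" "{x, a} \<in> snd G"
        by (auto simp: crossing_def)
      show "e \<in> ?lost \<union> prod.swap ` ?kept"
      proof (cases "a \<in> W")
        case True
        then have "a \<in> ?N" using xa U(1) by (auto simp: nbhd_def induced_subgraph_def)
        then have "(a, x) \<in> ?kept" using xa by (simp add: nbrs_def insert_commute)
        then show ?thesis using xa by force
      qed (use xa in \<open>simp add: nbrs_def\<close>)
    qed
    then have "card (crossing G U) \<le> card (?lost \<union> prod.swap ` ?kept)"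
      using fW fN finite_nbrs[OF s] by (intro card_mono) auto
    also have "\<dots> \<le> card ?lost + card ?kept"
      by (rule le_trans[OF card_Un_le]) (simp add: card_image)
    finally have cr: "card (crossing G U) \<le> card ?lost + card ?kept" .
    have "16 * card ?lost = (\<Sum>x\<in>U. 16 * card (nbrs G x - W))"
      using fW finite_nbrs[OF s] by (simp add: card_SigmaI sum_distrib_left)
    also have "\<dots> \<le> (\<Sum>x\<in>U. d)" using loss U by (intro sum_mono) auto
    finally have lost: "16 * card ?lost \<le> d * card U" by (simp add: mult.commute)
    have "card ?kept = (\<Sum>a\<in>?N. card (nbrs G a))"
      using fN finite_nbrs[OF s] by (simp add: card_SigmaI)
    also have "\<dots> = (\<Sum>a\<in>?N. d)"
      using G W by (intro sum.cong refl)
        (auto simp: nbhd_def induced_subgraph_def regular_graph_def simp flip: degree_eq_card_nbrs)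
    finally have kept: "card ?kept = d * card ?N" by (simp add: mult.commute)
    have "d * card U < d * (16 * card ?N)" using big cr lost kept by linarith
    then have "card U < 16 * card ?N" using d by simp
    then show ?thesis by simp
  qed simp
qed

lemma prob_all_deleted:
  assumes "finite V" "A \<subseteq> V" "0 \<le> p" "p \<le> 1"
  shows "measure_pmf.prob (Pi_pmf V False (\<lambda>_. bernoulli_pmf p)) {del. \<forall>v\<in>A. del v} = p ^ card A"
proof -
  have "{del. \<forall>v\<in>A. del v} = Pi V (\<lambda>v. if v \<in> A then {True} else UNIV)"
    using assms(2) by (auto simp: Pi_def)
  then have "measure_pmf.prob (Pi_pmf V False (\<lambda>_. bernoulli_pmf p)) {del. \<forall>v\<in>A. del v}
      = (\<Prod>v\<in>V. if v \<in> A then p else 1)"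
    using assms by (auto simp: measure_Pi_pmf_Pi measure_pmf_single intro!: prod.cong)
  also have "\<dots> = (\<Prod>v\<in>A. p)"
    using assms(1,2) by (simp add: prod.If_cases Int_absorb1)
  finally show ?thesis by simp
qed

text \<open>If the subgraph is not an expander, some surviving vertex has more than \<open>d / 16\<close> deleted
  neighbours. The union bound runs over this vertex and over \<open>d div 16 + 1\<close> of these neighbours,
  for which there are at most \<open>2 ^ d\<close> choices.\<close>

lemma prob_deletion_not_expander:
  fixes p :: real
  assumes G: "regular_graph d G" "edge_expanding d G" and d: "0 < d" and p: "0 \<le> p" "p \<le> 1"
  shows "measure_pmf.prob (random_deletion p G) {H. \<not> expander (1 / 16) H}
    \<le> card (fst G) * 2 ^ d * p ^ (d div 16 + 1)"
proof -
  define m where "m = d div 16 + 1"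
  let ?P = "Pi_pmf (fst G) False (\<lambda>_. bernoulli_pmf p)"
  let ?W = "\<lambda>del. {v \<in> fst G. \<not> del v}"
  define \<A> where "\<A> v = {A. A \<subseteq> nbrs G v \<and> card A = m}" for v
  have s: "simple_graph G" and fV: "finite (fst G)" using G by (auto simp: regular_graph_def simple_graph_def)
  have fA: "finite (\<A> v)" for v using finite_nbrs[OF s] by (simp add: \<A>_def)
  have "{del. \<not> expander (1 / 16) (induced_subgraph G (?W del))}
      \<subseteq> (\<Union>v\<in>fst G. \<Union>A\<in>\<A> v. {del. \<forall>w\<in>A. del w})"
  proof
    fix del assume "del \<in> {del. \<not> expander (1 / 16) (induced_subgraph G (?W del))}"
    then obtain v where v: "v \<in> ?W del" "d < 16 * card (nbrs G v - ?W del)"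
      using expander_induced_subgraph[OF G d, of "?W del"] by fastforce
    then have "m \<le> card (nbrs G v - ?W del)" by (simp add: m_def)
    then obtain A where A: "A \<subseteq> nbrs G v - ?W del" "card A = m"
      by (meson obtain_subset_with_card_n)
    then have "A \<in> \<A> v" "\<forall>w\<in>A. del w"
      using nbrs_subset[OF s, of v] by (auto simp: \<A>_def)
    then show "del \<in> (\<Union>v\<in>fst G. \<Union>A\<in>\<A> v. {del. \<forall>w\<in>A. del w})" using v by blast
  qed
  then have "measure_pmf.prob ?P {del. \<not> expander (1 / 16) (induced_subgraph G (?W del))}
      \<le> measure_pmf.prob ?P (\<Union>v\<in>fst G. \<Union>A\<in>\<A> v. {del. \<forall>w\<in>A. del w})"
    by (intro measure_pmf.finite_measure_mono) auto
  also have "\<dots> \<le> (\<Sum>v\<in>fst G. measure_pmf.prob ?P (\<Union>A\<in>\<A> v. {del. \<forall>w\<in>A. del w}))"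
    using fV by (intro measure_UNION_le) auto
  also have "\<dots> \<le> (\<Sum>v\<in>fst G. 2 ^ d * p ^ m)"
  proof (rule sum_mono)
    fix v assume v: "v \<in> fst G"
    have "measure_pmf.prob ?P (\<Union>A\<in>\<A> v. {del. \<forall>w\<in>A. del w})
        \<le> (\<Sum>A\<in>\<A> v. measure_pmf.prob ?P {del. \<forall>w\<in>A. del w})"
      using fA by (intro measure_UNION_le) auto
    also have "\<dots> = (\<Sum>A\<in>\<A> v. p ^ m)"
    proof (intro sum.cong refl)
      fix A assume "A \<in> \<A> v"
      then have "A \<subseteq> fst G" "card A = m" using nbrs_subset[OF s, of v] by (auto simp: \<A>_def)
      then show "measure_pmf.prob ?P {del. \<forall>w\<in>A. del w} = p ^ m"
        using prob_all_deleted[OF fV _ p] by simp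
    qed
    also have "\<dots> = real (d choose m) * p ^ m"
      using n_subsets[OF finite_nbrs[OF s], of v m] G v
      by (simp add: \<A>_def regular_graph_def flip: degree_eq_card_nbrs[OF s])
    also have "\<dots> \<le> 2 ^ d * p ^ m"
      using of_nat_mono[OF binomial_le_pow2[of d m], where 'a = real] p
      by (intro mult_right_mono) simp_all
    finally show "measure_pmf.prob ?P (\<Union>A\<in>\<A> v. {del. \<forall>w\<in>A. del w}) \<le> 2 ^ d * p ^ m" .
  qed
  finally show ?thesis by (simp add: random_deletion_def vimage_def m_def mult.assoc)
qed

lemma prob_not_expander:
  fixes p :: real
  assumes e: "even (d * n)" and d: "32 \<le> d" "16 * d \<le> n" and p: "0 \<le> p" "p \<le> 1"
  shows "measure_pmf.prob (deleted_regular_graph n d p) {H. \<not> expander (1 / 16) H}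
    \<le> 2 * (1 / 8) ^ (d div 16 - 1) + n * 2 ^ d * p ^ (d div 16 + 1)"
proof -
  let ?R = "regular_graphs n d" and ?X = "{H. \<not> expander (1 / 16) H}"
  let ?B = "{G. \<not> edge_expanding d G}"
  define \<delta> where "\<delta> = n * 2 ^ d * p ^ (d div 16 + 1)"
  have R: "finite ?R" "?R \<noteq> {}"
    using finite_regular_graphs_on[of "{..<n}"] regular_graphs_nonempty[OF e] d
    by (auto simp: regular_graphs_eq)
  have \<delta>: "0 \<le> \<delta>" using p by (simp add: \<delta>_def)
  have "?R \<inter> ?B = {G. regular_graph d G \<and> fst G = {..<n} \<and> \<not> edge_expanding d G}"
    by (auto simp: regular_graphs_eq)
  then have "real (card (?R \<inter> ?B)) \<le> 2 * (1 / 8) ^ (d div 16 - 1) * real (card ?R)"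
    using card_not_edge_expanding[of "{..<n}" d] d by (simp add: regular_graphs_eq)
  then have B: "measure_pmf.prob (random_regular_graph n d) ?B \<le> 2 * (1 / 8) ^ (d div 16 - 1)"
    using R by (simp add: random_regular_graph_def measure_pmf_of_set card_gt_0_iff divide_le_eq)
  have "ennreal (measure_pmf.prob (deleted_regular_graph n d p) ?X)
      = (\<integral>\<^sup>+ G. emeasure (random_deletion p G) ?X \<partial>random_regular_graph n d)"
    by (simp add: deleted_regular_graph_def emeasure_bind_pmf flip: measure_pmf.emeasure_eq_measure)
  also have "\<dots> \<le> (\<integral>\<^sup>+ G. indicator ?B G + ennreal \<delta> \<partial>random_regular_graph n d)"
  proof (rule nn_integral_mono_AE, unfold AE_measure_pmf_iff, rule ballI)
    fix G assume "G \<in> set_pmf (random_regular_graph n d)"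
    then have G: "regular_graph d G" "fst G = {..<n}"
      using R by (auto simp: random_regular_graph_def regular_graphs_eq)
    show "emeasure (random_deletion p G) ?X \<le> indicator ?B G + ennreal \<delta>"
    proof (cases "edge_expanding d G")
      case True
      then show ?thesis
        using prob_deletion_not_expander[OF G(1) True _ p] d G(2) \<delta>
        by (simp add: measure_pmf.emeasure_eq_measure \<delta>_def ennreal_leI)
    next
      case False
      have "emeasure (random_deletion p G) ?X \<le> 1" by (rule measure_pmf.emeasure_le_1)
      also have "1 \<le> indicator ?B G + ennreal \<delta>" using False by simp
      finally show ?thesis .
    qed
  qed
  also have "\<dots> = ennreal (measure_pmf.prob (random_regular_graph n d) ?B + \<delta>)"
    using \<delta> by (simp add: nn_integral_add measure_pmf.emeasure_eq_measure)
  finally have "measure_pmf.prob (deleted_regular_graph n d p) ?X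
      \<le> measure_pmf.prob (random_regular_graph n d) ?B + \<delta>"
    using \<delta> by (simp add: ennreal_le_iff del: ennreal_plus)
  then show ?thesis using B by (simp add: \<delta>_def)
qed

section \<open>The limit\<close>

text \<open>Since \<open>2\<close> is dominated by \<open>n\<close> to the power \<open>\<alpha> / 32\<close>, half of the exponent \<open>\<alpha> d / 16\<close> gained
  from the deletion probability absorbs \<open>2 ^ d\<close>. The other half is at least \<open>2\<close>, which absorbs the
  factor \<open>n\<close> and leaves \<open>1 / n\<close>. A lower bound on \<open>d\<close> by a constant suffices, so \<open>d\<close> may tend to
  infinity arbitrarily slowly.\<close>

lemma deletion_error_bound:
  fixes \<alpha> n :: real and d :: nat
  assumes \<alpha>: "0 < \<alpha>" and n: "1 \<le> n" "2 \<le> n powr (\<alpha> / 32)" and d: "64 / \<alpha> \<le> d"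
  shows "n * 2 ^ d * (n powr (- \<alpha>)) ^ (d div 16 + 1) \<le> 1 / n"
proof -
  have "64 \<le> d * \<alpha>" using d \<alpha> by (simp only: pos_divide_le_eq)
  then have ad: "2 \<le> \<alpha> * d / 32" by (simp add: mult.commute)
  have "(n powr (- \<alpha>)) ^ (d div 16 + 1) = n powr (real (d div 16 + 1) * (- \<alpha>))"
    using n by (intro powr_power) simp
  also have "\<dots> \<le> n powr (- (\<alpha> * d / 16))"
  proof (rule powr_mono)
    have "d \<le> 16 * (d div 16 + 1)" using dividend_less_times_div[of 16 d] by simp
    from of_nat_mono[OF this, where 'a = real]
    have "d / 16 \<le> real (d div 16 + 1)" by simp
    then have "\<alpha> * (d / 16) \<le> \<alpha> * real (d div 16 + 1)" using \<alpha> by (intro mult_left_mono) auto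
    then show "real (d div 16 + 1) * (- \<alpha>) \<le> - (\<alpha> * d / 16)" by (simp add: mult.commute)
  qed (use n in simp)
  finally have del: "(n powr (- \<alpha>)) ^ (d div 16 + 1) \<le> n powr (- (\<alpha> * d / 16))" .
  have "2 ^ d \<le> (n powr (\<alpha> / 32)) ^ d" using n by (intro power_mono) auto
  also have "\<dots> = n powr (d * (\<alpha> / 32))" using n by (intro powr_power) simp
  finally have "2 ^ d * (n powr (- \<alpha>)) ^ (d div 16 + 1) \<le> n powr (d * (\<alpha> / 32)) * n powr (- (\<alpha> * d / 16))"
    using del by (intro mult_mono) auto
  also have "\<dots> = n powr (d * (\<alpha> / 32) + - (\<alpha> * d / 16))" by (rule powr_add[symmetric])
  also have "d * (\<alpha> / 32) + - (\<alpha> * d / 16) = - (\<alpha> * d / 32)" by simp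
  also have "n powr \<dots> \<le> n powr (- 2)" using ad n by (intro powr_mono) auto
  also have "n powr (- 2) = 1 / n ^ 2" using n by (simp add: powr_minus_divide)
  finally have "n * (2 ^ d * (n powr (- \<alpha>)) ^ (d div 16 + 1)) \<le> n * (1 / n ^ 2)"
    using n by (intro mult_left_mono) auto
  then show ?thesis using n by (simp add: power2_eq_square mult.assoc)
qed

theorem theorem4p3:
  fixes \<alpha> :: real and d :: "nat \<Rightarrow> nat"
  assumes "\<alpha> > 0"
    and "filterlim d at_top (even_product d)"
    and "((\<lambda>n. real (d n) / sqrt (real n)) \<longlongrightarrow> 0) (even_product d)"
  shows "\<exists>\<beta>>0.
    ((\<lambda>n. measure_pmf.prob (deleted_regular_graph n (d n) (real n powr (- \<alpha>)))
             {H. expander \<beta> H}) \<longlongrightarrow> 1) (even_product d)"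
proof (intro exI conjI)
  let ?F = "even_product d"
  define P where "P n = measure_pmf.prob (deleted_regular_graph n (d n) (real n powr (- \<alpha>)))
    {H. \<not> expander (1 / 16) H}" for n
  have F: "?F \<le> sequentially" by (simp add: even_product_def)
  have even: "\<forall>\<^sub>F n in ?F. even (d n * n)"
    by (simp add: even_product_def eventually_inf_principal)
  have large: "\<forall>\<^sub>F n in ?F. K \<le> d n" for K
    using assms(2) by (simp add: filterlim_at_top)
  have seq: "\<forall>\<^sub>F n in ?F. Q n" if "\<forall>\<^sub>F n in sequentially. Q n" for Q
    using that F by (rule filter_leD[rotated])
  have sparse: "\<forall>\<^sub>F n in ?F. 16 * d n \<le> n"
  proof -
    have "\<forall>\<^sub>F n in ?F. real (d n) / sqrt (real n) < 1 / 16"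
      using assms(3) by (rule order_tendstoD) simp
    then show ?thesis using seq[OF eventually_gt_at_top[of 0]]
    proof eventually_elim
      case (elim n)
      then have "16 * real (d n) < sqrt (real n)" by (simp add: field_simps)
      also have "sqrt (real n) \<le> real n" 
        using mult_left_mono[of 1 "real n" "real n"] elim(2)
        by (intro real_le_lsqrt) (simp_all add: power2_eq_square)
      finally show ?case by linarith
    qed
  qed
  have "\<forall>\<^sub>F n in sequentially. 2 \<le> real n powr (\<alpha> / 32)"
    using assms(1) by real_asymp
  note big = seq[OF this]
  have bound: "\<forall>\<^sub>F n in ?F. P n \<le> 2 * (1 / 8) ^ (d n div 16 - 1) + 1 / real n"
    using even large[of 32] large[of "nat \<lceil>64 / \<alpha>\<rceil>"] sparse big seq[OF eventually_gt_at_top[of 0]]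
  proof eventually_elim
    case (elim n)
    define p where "p = real n powr (- \<alpha>)"
    have n1: "1 \<le> real n" using elim by simp
    have p: "0 \<le> p" "p \<le> 1"
      using n1 assms(1) powr_mono[of "- \<alpha>" 0 "real n"] by (simp_all add: p_def)
    have "64 / \<alpha> \<le> real (nat \<lceil>64 / \<alpha>\<rceil>)" by (rule real_nat_ceiling_ge)
    also have "\<dots> \<le> real (d n)" using elim(3) by (rule of_nat_mono)
    finally have "n * 2 ^ d n * p ^ (d n div 16 + 1) \<le> 1 / real n"
      using deletion_error_bound[OF assms(1) n1 elim(5)] by (simp add: p_def)
    then show ?case
      using prob_not_expander[OF elim(1,2,4) p] by (simp add: P_def p_def)
  qed
  have "((\<lambda>n. 2 * (1 / 8 :: real) ^ (d n div 16 - 1) + 1 / real n) \<longlongrightarrow> 2 * 0 + 0) ?F"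
  proof (intro tendsto_add tendsto_mult tendsto_const)
    have "filterlim (\<lambda>k::nat. k div 16 - 1) at_top at_top"
      unfolding filterlim_at_top
    proof
      fix K :: nat
      show "\<forall>\<^sub>F k in at_top. K \<le> k div 16 - 1"
        using eventually_ge_at_top[of "16 * (K + 1)"] 
      proof eventually_elim
        case (elim k)
        then have "16 * (K + 1) div 16 \<le> k div 16" by (rule div_le_mono)
        then show ?case by simp
      qed
    qed
    moreover have "(\<lambda>k. (1 / 8 :: real) ^ k) \<longlonglongrightarrow> 0" by (rule LIMSEQ_power_zero) simp
    ultimately have "(\<lambda>k. (1 / 8 :: real) ^ (k div 16 - 1)) \<longlonglongrightarrow> 0"
      by (rule filterlim_compose[rotated])
    then show "((\<lambda>n. (1 / 8 :: real) ^ (d n div 16 - 1)) \<longlongrightarrow> 0) ?F"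
      using assms(2) by (rule filterlim_compose)
    show "((\<lambda>n. 1 / real n) \<longlongrightarrow> 0) ?F" by (rule tendsto_mono[OF F lim_1_over_n])
  qed
  then have "(P \<longlongrightarrow> 0) ?F"
    using bound by (intro tendsto_sandwich[of "\<lambda>_. 0" P]) (auto simp: P_def)
  then have "((\<lambda>n. 1 - P n) \<longlongrightarrow> 1 - 0) ?F" by (intro tendsto_diff tendsto_const)
  moreover have "1 - P n = measure_pmf.prob (deleted_regular_graph n (d n) (real n powr (- \<alpha>)))
      {H. expander (1 / 16) H}" for n
    unfolding P_def by (subst measure_pmf.prob_compl[symmetric]) (auto intro!: arg_cong2[where f = measure])
  ultimately show "((\<lambda>n. measure_pmf.prob (deleted_regular_graph n (d n) (real n powr (- \<alpha>)))
      {H. expander (1 / 16) H}) \<longlongrightarrow> 1) ?F" by simp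
qed simp

end
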